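(* Let $(f,M)$ be a polymatroid, $X\subsetneq M$, and $(f',M')=(f,M)\,/\,X$ the contract of $(f,M)$ along $X$ (so $M'=M\setminus X$). Let $(g',N')$ be an extension of $(f',M')$. Then there is an extension $(g,N)$ of $(f,M)$, with $N=N'\cup X$, such that $(g',N')=(g,N)\,/\,X$.
   Context: A polymatroid $(f,M)$: finite $M$, $f$ on subsets of $M$ (with $f(\emptyset)=0$), non-negative, monotone, submodular. $(g,N)$ is an extension of $(f,M)$ if $N\supseteq M$ and $g(A)=f(A)$ for all $A\subseteq M$. The contract of $(f,M)$ along $X\subset M$ is the polymatroid $(h,M\setminus X)$ with $h(A)=f(A\cup X)-f(X)$ for $A\subseteq M\setminus X$.
   Formalization: The formal statement adds the implicit assumption that N' is disjoint from X; without it the claim fails, since (g',N') = (g,N)/X with N = N'∪X forces N' = N\X. *)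

theory Defs
  imports Complex_Main
begin

text \<open>
  A set function on the subsets of a ground set \<open>M\<close> is represented by a total function of type
  \<open>'a set \<Rightarrow> real\<close>. Only its values on subsets of \<open>M\<close> are meaningful, so two polymatroids are equal
  when their ground sets are equal and the functions agree on all subsets of the ground set. For
  this reason ``is the contract of'' is a relation that leaves values outside the ground set free.
\<close>

definition polymatroid :: "('a set \<Rightarrow> real) \<Rightarrow> 'a set \<Rightarrow> bool" where
  "polymatroid f M \<longleftrightarrow>
     finite M \<and>
     f {} = 0 \<and>
     (\<forall>A. A \<subseteq> M \<longrightarrow> 0 \<le> f A) \<and>
     (\<forall>A B. A \<subseteq> B \<and> B \<subseteq> M \<longrightarrow> f A \<le> f B) \<and>
     (\<forall>A B. A \<subseteq> M \<and> B \<subseteq> M \<longrightarrow> f (A \<union> B) + f (A \<inter> B) \<le> f A + f B)"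

definition extension_of ::
    "('a set \<Rightarrow> real) \<Rightarrow> 'a set \<Rightarrow> ('a set \<Rightarrow> real) \<Rightarrow> 'a set \<Rightarrow> bool" where
  "extension_of g N f M \<longleftrightarrow>
     polymatroid f M \<and> polymatroid g N \<and> M \<subseteq> N \<and> (\<forall>A. A \<subseteq> M \<longrightarrow> g A = f A)"

definition contract_of ::
    "('a set \<Rightarrow> real) \<Rightarrow> 'a set \<Rightarrow> ('a set \<Rightarrow> real) \<Rightarrow> 'a set \<Rightarrow> 'a set \<Rightarrow> bool" where
  "contract_of h M' f M X \<longleftrightarrow>
     X \<subseteq> M \<and> M' = M - X \<and> (\<forall>A. A \<subseteq> M' \<longrightarrow> h A = f (A \<union> X) - f X)"

end

theory Submission imports Defs
begin

text \<open>
  Put \<open>p A = f X + g' (A - X)\<close>, the values forced on the sets containing \<open>X\<close>, and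
  \<open>q A = f (A \<inter> M) + K * card (A - M)\<close>, the extension of \<open>f\<close> by independent new elements of
  rank \<open>K = g' N'\<close>. Both are monotone and submodular, \<open>q \<le> p\<close> on subsets of \<open>M\<close> and \<open>p \<le> q\<close> on
  supersets of \<open>X\<close>. So \<open>g = min p q\<close> has the required values. It is submodular because
  \<open>p - q\<close> is decreasing.
\<close>

lemma polymatroidD:
  assumes "polymatroid f M"
  shows "finite M" "f {} = 0" "A \<subseteq> M \<Longrightarrow> 0 \<le> f A"
    and "A \<subseteq> B \<Longrightarrow> B \<subseteq> M \<Longrightarrow> f A \<le> f B"
    and "A \<subseteq> M \<Longrightarrow> B \<subseteq> M \<Longrightarrow> f (A \<union> B) + f (A \<inter> B) \<le> f A + f B"
  using assms unfolding polymatroid_def by blast+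

text \<open>If the same function attains the minimum at \<open>A\<close> and at \<open>B\<close>,
  its own submodularity suffices. If \<open>p\<close> attains it at \<open>A\<close> and
  \<open>q\<close> at \<open>B\<close>, submodularity of \<open>p\<close> bounds
  \<open>p A + q B\<close> below by
  \<open>p (A \<union> B) + p (A \<inter> B) - (p B - q B)\<close>, and \<open>anti\<close> for
  \<open>A \<inter> B\<close> and \<open>B\<close> turns this into
  \<open>p (A \<union> B) + q (A \<inter> B)\<close>. The other case is symmetric.\<close>

lemma min_submodular:
  fixes p q :: "'a set \<Rightarrow> real"
  assumes p: "\<And>A B. A \<subseteq> N \<Longrightarrow> B \<subseteq> N \<Longrightarrow> p (A \<union> B) + p (A \<inter> B) \<le> p A + p B"
    and q: "\<And>A B. A \<subseteq> N \<Longrightarrow> B \<subseteq> N \<Longrightarrow> q (A \<union> B) + q (A \<inter> B) \<le> q A + q B"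
    and anti: "\<And>A B. A \<subseteq> B \<Longrightarrow> B \<subseteq> N \<Longrightarrow> p B - q B \<le> p A - q A"
    and "A \<subseteq> N" "B \<subseteq> N"
  shows "min (p (A \<union> B)) (q (A \<union> B)) + min (p (A \<inter> B)) (q (A \<inter> B))
    \<le> min (p A) (q A) + min (p B) (q B)"
  using p[OF assms(4,5)] q[OF assms(4,5)] anti[of "A \<inter> B" A] anti[of "A \<inter> B" B] assms(4,5)
  by (auto simp: min_def)

text \<open>Submodularity is applied to \<open>B\<close> and \<open>A \<union> W\<close>: their
  union is \<open>B \<union> W\<close>, and their intersection contains \<open>A\<close>. Since
  monotonicity absorbs the rest of the intersection, \<open>W\<close> may meet
  \<open>B\<close>.\<close>

lemma polymatroid_diminishing:
  assumes f: "polymatroid f M" and "A \<subseteq> B" "B \<subseteq> M" "W \<subseteq> M"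
  shows "f (B \<union> W) - f (A \<union> W) \<le> f B - f A"
proof -
  have "f (B \<union> (A \<union> W)) + f (B \<inter> (A \<union> W)) \<le> f B + f (A \<union> W)"
    using assms by (intro polymatroidD(5)[OF f]) auto
  moreover have "B \<union> (A \<union> W) = B \<union> W" using assms by auto
  moreover have "f A \<le> f (B \<inter> (A \<union> W))"
    using assms by (intro polymatroidD(4)[OF f]) auto
  ultimately show ?thesis by simp
qed

theorem theorem4:
  fixes f f' g' :: "'a set \<Rightarrow> real" and M M' N' X :: "'a set"
  assumes "polymatroid f M"
    and "X \<subset> M"
    and "contract_of f' M' f M X"
    and "extension_of g' N' f' M'"
    and "N' \<inter> X = {}"
  shows "\<exists>g N. extension_of g N f M \<and> N = N' \<union> X \<and> contract_of g' N' g N X"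
proof -
  note f = assms(1)
  have g': "polymatroid g' N'" and sub: "M' \<subseteq> N'" and ext: "\<And>A. A \<subseteq> M' \<Longrightarrow> g' A = f' A"
    using assms(4) by (auto simp: extension_of_def)
  have M': "M' = M - X" and con: "\<And>A. A \<subseteq> M' \<Longrightarrow> f' A = f (A \<union> X) - f X"
    using assms(3) by (auto simp: contract_of_def)
  have XM: "X \<subseteq> M" using assms(2) by auto
  have g'_contr: "g' A = f (A \<union> X) - f X" if "A \<subseteq> M - X" for A
    using that ext con M' by simp
  define N where "N = N' \<union> X"
  define K where "K = g' N'"
  define p where "p A = f X + g' (A - X)" for A
  define q where "q A = f (A \<inter> M) + K * card (A - M)" for A
  define g where "g A = min (p A) (q A)" for A
  have MN: "M \<subseteq> N" using sub M' XM by (auto simp: N_def)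
  have fin: "finite N"
    using polymatroidD(1)[OF f] polymatroidD(1)[OF g'] XM by (auto simp: N_def intro: finite_subset)
  have K0: "0 \<le> K" unfolding K_def by (simp add: polymatroidD(3)[OF g'])
  have NX: "A - X \<subseteq> N'" if "A \<subseteq> N" for A using that by (auto simp: N_def)

  have p_mono: "p A \<le> p B" if "A \<subseteq> B" "B \<subseteq> N" for A B
    unfolding p_def using that NX by (auto intro!: polymatroidD(4)[OF g'])
  have q_mono: "q A \<le> q B" if "A \<subseteq> B" "B \<subseteq> N" for A B
  proof -
    have "card (A - M) \<le> card (B - M)"
      using that fin by (intro card_mono) (auto intro: finite_subset)
    moreover have "f (A \<inter> M) \<le> f (B \<inter> M)"
      using that by (intro polymatroidD(4)[OF f]) auto
    ultimately show ?thesis unfolding q_def using K0 by (intro add_mono mult_left_mono) auto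
  qed
  have p_submod: "p (A \<union> B) + p (A \<inter> B) \<le> p A + p B" if "A \<subseteq> N" "B \<subseteq> N" for A B
  proof -
    have "(A - X) \<inter> (B - X) = (A \<inter> B) - X" by auto
    then show ?thesis
      using polymatroidD(5)[OF g' NX[OF that(1)] NX[OF that(2)]] by (simp add: p_def Un_Diff)
  qed
  have q_submod: "q (A \<union> B) + q (A \<inter> B) \<le> q A + q B" if "A \<subseteq> N" "B \<subseteq> N" for A B
  proof -
    \<comment> \<open>The cardinality term is modular, so it contributes an equality and only
      \<open>f\<close> has to be submodular.\<close>
    have "finite (A - M)" "finite (B - M)" using that fin by (auto intro: finite_subset)
    moreover have "(A - M) \<inter> (B - M) = (A \<inter> B) - M" by auto
    ultimately have "card (A - M) + card (B - M) = card ((A \<union> B) - M) + card ((A \<inter> B) - M)"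
      using card_Un_Int[of "A - M" "B - M"] by (simp add: Un_Diff)
    then have "K * card (A - M) + K * card (B - M)
        = K * card ((A \<union> B) - M) + K * card ((A \<inter> B) - M)"
      by (metis distrib_left of_nat_add)
    moreover have "f ((A \<union> B) \<inter> M) + f ((A \<inter> B) \<inter> M) \<le> f (A \<inter> M) + f (B \<inter> M)"
      using polymatroidD(5)[OF f, of "A \<inter> M" "B \<inter> M"]
      by (simp add: Int_Un_distrib Int_Un_distrib2 Int_ac)
    ultimately show ?thesis unfolding q_def by linarith
  qed

  have anti: "p B - q B \<le> p A - q A" if AB: "A \<subseteq> B" "B \<subseteq> N" for A B
  proof (cases "A - M = B - M")
    case True
    \<comment> \<open>No new element is gained, so \<open>p\<close> alone sees the common part
      \<open>B - M\<close>. Diminishing returns of \<open>g'\<close> discard it. What remains lies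
      in \<open>M - X\<close>, where \<open>g'\<close> is given by \<open>f\<close>, and diminishing
      returns of \<open>f\<close> discard \<open>X\<close>.\<close>
    have "g' ((B \<inter> M - X) \<union> (B - M)) - g' ((A \<inter> M - X) \<union> (B - M))
        \<le> g' (B \<inter> M - X) - g' (A \<inter> M - X)"
      using AB XM by (intro polymatroid_diminishing[OF g']) (auto simp: N_def)
    moreover have "(B \<inter> M - X) \<union> (B - M) = B - X" "(A \<inter> M - X) \<union> (B - M) = A - X"
      using True XM by auto
    moreover have "g' (C \<inter> M - X) = f ((C \<inter> M) \<union> X) - f X" for C
      using g'_contr[of "C \<inter> M - X"] by auto
    moreover have "f ((B \<inter> M) \<union> X) - f ((A \<inter> M) \<union> X) \<le> f (B \<inter> M) - f (A \<inter> M)"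
      using AB XM by (intro polymatroid_diminishing[OF f]) auto
    ultimately show ?thesis using True by (simp add: p_def q_def)
  next
    case False
    \<comment> \<open>At least one new element is gained, which raises \<open>q\<close> by at least
      \<open>K\<close>. As \<open>K\<close> is the largest value of \<open>g'\<close>,
      \<open>p\<close> cannot grow by more than that.\<close>
    have "card (A - M) < card (B - M)"
      using False AB fin by (intro psubset_card_mono) (auto intro: finite_subset)
    then have "K * (1 + card (A - M)) \<le> K * card (B - M)"
      using K0 by (intro mult_left_mono) auto
    then have "K + K * card (A - M) \<le> K * card (B - M)" by (simp add: distrib_left)
    moreover have "g' (B - X) \<le> K" unfolding K_def
      using NX AB by (intro polymatroidD(4)[OF g']) auto
    moreover have "0 \<le> g' (A - X)"
      using NX AB by (intro polymatroidD(3)[OF g']) auto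
    moreover have "f (A \<inter> M) \<le> f (B \<inter> M)"
      using AB by (intro polymatroidD(4)[OF f]) auto
    ultimately show ?thesis by (simp add: p_def q_def)
  qed

  have gf: "g A = f A" if "A \<subseteq> M" for A
  proof -
    \<comment> \<open>The contract formula is used at \<open>A - X\<close>, where
      \<open>(A - X) \<union> X = A \<union> X\<close> and the two terms \<open>f X\<close>
      cancel.\<close>
    have "p A = f (A \<union> X)" using g'_contr[OF Diff_mono[OF that subset_refl]] by (simp add: p_def)
    moreover have "f A \<le> f (A \<union> X)" using that XM by (intro polymatroidD(4)[OF f]) auto
    moreover have "q A = f A" using that by (simp add: q_def Int_absorb2 Diff_eq_empty_iff[THEN iffD2])
    ultimately show ?thesis by (simp add: g_def)
  qed
  have gX: "g A = p A" if "X \<subseteq> A" "A \<subseteq> N" for A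
  proof -
    \<comment> \<open>Both values are \<open>f X\<close>. Hence the decreasing difference
      \<open>p - q\<close> is zero at \<open>X\<close> and at most zero on every superset of
      \<open>X\<close> in \<open>N\<close>.\<close>
    have "p X = q X" using polymatroidD(2)[OF g'] XM
      by (simp add: p_def q_def Int_absorb2 Diff_eq_empty_iff[THEN iffD2])
    then show ?thesis using anti[OF that] by (simp add: g_def)
  qed
  have g_mono: "g A \<le> g B" if "A \<subseteq> B" "B \<subseteq> N" for A B
    unfolding g_def using p_mono[OF that] q_mono[OF that] by (rule min.mono)
  have g0: "g {} = 0" using gf[of "{}"] polymatroidD(2)[OF f] by simp
  have "polymatroid g N"
    unfolding polymatroid_def
  proof (intro conjI allI impI)
    show "0 \<le> g A" if "A \<subseteq> N" for A using g_mono[of "{}" A] g0 that by simp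
    show "g (A \<union> B) + g (A \<inter> B) \<le> g A + g B" if "A \<subseteq> N \<and> B \<subseteq> N" for A B
      using min_submodular[of N p q, OF p_submod q_submod anti] that by (simp add: g_def)
  qed (use fin g0 g_mono in auto)
  then have "extension_of g N f M"
    using f MN gf by (simp add: extension_of_def)
  moreover have "contract_of g' N' g N X"
    unfolding contract_of_def
  proof (intro conjI allI impI)
    show "X \<subseteq> N" "N' = N - X" using assms(5) by (auto simp: N_def)
    fix A assume A: "A \<subseteq> N'"
    \<comment> \<open>Disjointness of \<open>N'\<close> and \<open>X\<close> is what lets
      \<open>p (A \<union> X)\<close> recover \<open>g' A\<close> itself.\<close>
    then have "A \<union> X - X = A" using assms(5) by auto
    moreover have "g (A \<union> X) = p (A \<union> X)" using A by (intro gX) (auto simp: N_def)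
    ultimately show "g' A = g (A \<union> X) - g X"
      using gf[OF XM] by (simp add: p_def)
  qed
  ultimately show ?thesis using N_def by blast
qed

end
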